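(* Let $\mathcal{C}$ be a chordal clutter. Then the independence complex $I(\mathcal{C})$ is shellable, and hence sequentially Cohen-Macaulay (over any field or over $\mathbb{Z}$).
   Context: A clutter $\mathcal{C}$ on a finite vertex set $V$ is a set of subsets of $V$ (called circuits) such that no circuit properly contains another. The independence complex $I(\mathcal{C})$ is the simplicial complex on $V$ whose faces are the subsets of $V$ containing no circuit of $\mathcal{C}$. For $v\in V$, the deletion $\mathcal{C}\setminus v$ is the clutter on $V\setminus\{v\}$ whose circuits are the circuits of $\mathcal{C}$ not containing $v$; the contraction $\mathcal{C}/v$ is the clutter on $V\setminus\{v\}$ whose circuits are the inclusion-minimal sets among $\{e\setminus\{v\} : e \text{ a circuit of } \mathcal{C}\}$. A minor of $\mathcal{C}$ is a clutter obtained from $\mathcal{C}$ by a sequence (possibly empty) of deletions and contractions. A vertex $v$ of a clutter is simplicial if for every two circuits $e_1,e_2$ containing $v$ there is a circuit $e_3\subseteq (e_1\cup e_2)\setminus\{v\}$. A clutter is chordal if every minor of it (having at least one vertex) has a simplicial vertex. A simplicial complex (not necessarily pure) is shellable if its facets can be ordered $\sigma_1,\dots,\sigma_m$ so that for each $i\ge 2$ the intersection of $\sigma_i$ with the complex generated by $\sigma_1,\dots,\sigma_{i-1}$ is pure of dimension $\dim\sigma_i-1$. A complex is sequentially Cohen-Macaulay if for every $d$ its pure $d$-skeleton (the subcomplex generated by its $d$-dimensional faces) is Cohen-Macaulay. *)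

theory Defs
  imports "HOL-Algebra.Elementary_Groups"
begin

definition clutter :: "'a set \<Rightarrow> 'a set set \<Rightarrow> bool" where
  "clutter V C \<longleftrightarrow> finite V \<and> C \<subseteq> Pow V \<and> (\<forall>e\<in>C. \<forall>f\<in>C. \<not> e \<subset> f)"

definition deletion :: "'a set set \<Rightarrow> 'a \<Rightarrow> 'a set set" where
  "deletion C v = {e \<in> C. v \<notin> e}"

definition contraction :: "'a set set \<Rightarrow> 'a \<Rightarrow> 'a set set" where
  "contraction C v =
     {f \<in> (\<lambda>e. e - {v}) ` C. \<not> (\<exists>g \<in> (\<lambda>e. e - {v}) ` C. g \<subset> f)}"

inductive minor :: "'a set \<Rightarrow> 'a set set \<Rightarrow> 'a set \<Rightarrow> 'a set set \<Rightarrow> bool"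
  for V :: "'a set" and C :: "'a set set" where
  minor_refl: "minor V C V C"
| minor_deletion: "minor V C W D \<Longrightarrow> v \<in> W \<Longrightarrow> minor V C (W - {v}) (deletion D v)"
| minor_contraction: "minor V C W D \<Longrightarrow> v \<in> W \<Longrightarrow> minor V C (W - {v}) (contraction D v)"

(* "Two circuits" means two distinct circuits: for e1 = e2 the set e3 would be
   a circuit properly contained in the circuit e1. *)
definition simplicial_vertex :: "'a set \<Rightarrow> 'a set set \<Rightarrow> 'a \<Rightarrow> bool" where
  "simplicial_vertex V C v \<longleftrightarrow> v \<in> V \<and>
     (\<forall>e1\<in>C. \<forall>e2\<in>C. e1 \<noteq> e2 \<and> v \<in> e1 \<and> v \<in> e2 \<longrightarrow> (\<exists>e3\<in>C. e3 \<subseteq> (e1 \<union> e2) - {v}))"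

definition chordal :: "'a set \<Rightarrow> 'a set set \<Rightarrow> bool" where
  "chordal V C \<longleftrightarrow>
     (\<forall>W D. minor V C W D \<and> W \<noteq> {} \<longrightarrow> (\<exists>v. simplicial_vertex W D v))"

(* A complex is represented by its set of faces. It may be void ({}), which is
   different from {{}}: the independence complex is void if {} is a circuit. *)

definition independence_complex :: "'a set \<Rightarrow> 'a set set \<Rightarrow> 'a set set" where
  "independence_complex V C = {\<sigma>. \<sigma> \<subseteq> V \<and> \<not> (\<exists>e\<in>C. e \<subseteq> \<sigma>)}"

definition face_dim :: "'a set \<Rightarrow> int" where
  "face_dim \<sigma> = int (card \<sigma>) - 1"

definition complex_dim :: "'a set set \<Rightarrow> int" where
  "complex_dim K = Max (face_dim ` K)"

definition facets :: "'a set set \<Rightarrow> 'a set set" where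
  "facets K = {\<sigma> \<in> K. \<not> (\<exists>\<tau>\<in>K. \<sigma> \<subset> \<tau>)}"

definition generated_complex :: "'a set set \<Rightarrow> 'a set set" where
  "generated_complex F = {\<tau>. \<exists>\<sigma>\<in>F. \<tau> \<subseteq> \<sigma>}"

definition pure_of_dim :: "'a set set \<Rightarrow> int \<Rightarrow> bool" where
  "pure_of_dim K d \<longleftrightarrow> K \<noteq> {} \<and> (\<forall>\<sigma> \<in> facets K. face_dim \<sigma> = d)"

definition shelling :: "'a set set \<Rightarrow> 'a set list \<Rightarrow> bool" where
  "shelling K s \<longleftrightarrow> distinct s \<and> set s = facets K \<and>
     (\<forall>i. 0 < i \<and> i < length s \<longrightarrow>
        pure_of_dim (generated_complex {s ! i} \<inter> generated_complex (set (take i s)))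
          (face_dim (s ! i) - 1))"

definition shellable :: "'a set set \<Rightarrow> bool" where
  "shellable K \<longleftrightarrow> (\<exists>s. shelling K s)"

definition pure_skeleton :: "'a set set \<Rightarrow> int \<Rightarrow> 'a set set" where
  "pure_skeleton K d = generated_complex {\<sigma> \<in> K. face_dim \<sigma> = d}"

definition link :: "'a set set \<Rightarrow> 'a set \<Rightarrow> 'a set set" where
  "link K \<sigma> = {\<tau>. \<tau> \<inter> \<sigma> = {} \<and> \<tau> \<union> \<sigma> \<in> K}"

(* Oriented simplicial chains, without choosing an order on the vertices: an
   i-chain is an alternating function on the orderings of the i-dimensional
   faces, where c [v0, ..., vi] is the coefficient of the oriented simplex
   [v0, ..., vi]. The empty face is the unique face of dimension -1, so the
   complex is augmented and its homology is reduced. *)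
definition chain :: "'a set set \<Rightarrow> int \<Rightarrow> ('a list \<Rightarrow> 'k::comm_ring_1) \<Rightarrow> bool" where
  "chain K i c \<longleftrightarrow>
     (\<forall>xs. c xs \<noteq> 0 \<longrightarrow> distinct xs \<and> set xs \<in> K \<and> face_dim (set xs) = i) \<and>
     (\<forall>xs x y ys. c (xs @ y # x # ys) = - c (xs @ x # y # ys))"

(* Coefficientwise form of the usual boundary, the alternating sum over j of
   (-1)^j [v0, ..., (vj omitted), ..., vi]: the simplices having the oriented
   face xs in their boundary are, when oriented so that xs has coefficient +1
   there, the v # xs. *)
definition boundary :: "'a set set \<Rightarrow> ('a list \<Rightarrow> 'k::comm_ring_1) \<Rightarrow> 'a list \<Rightarrow> 'k" where
  "boundary K c = (\<lambda>xs. \<Sum>v\<in>\<Union>K. c (v # xs))"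

definition cycles :: "'a set set \<Rightarrow> int \<Rightarrow> ('a list \<Rightarrow> 'k::comm_ring_1) set" where
  "cycles K i = {c. chain K i c \<and> boundary K c = (\<lambda>_. 0)}"

definition boundaries :: "'a set set \<Rightarrow> int \<Rightarrow> ('a list \<Rightarrow> 'k::comm_ring_1) set" where
  "boundaries K i = boundary K ` {c. chain K (i + 1) c}"

definition cycle_group :: "'a set set \<Rightarrow> int \<Rightarrow> ('a list \<Rightarrow> 'k::comm_ring_1) monoid" where
  "cycle_group K i =
     \<lparr>carrier = cycles K i, mult = (\<lambda>c d xs. c xs + d xs), one = (\<lambda>_. 0)\<rparr>"

definition reduced_homology ::
    "'a set set \<Rightarrow> int \<Rightarrow> ('a list \<Rightarrow> 'k::comm_ring_1) set monoid" where
  "reduced_homology K i = cycle_group K i Mod boundaries K i"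

(* Homological (Reisner) definition, which makes sense over a field and over the
   integers; TYPE('k) names the coefficient ring. The link of a face contains {},
   so complex_dim is only applied to complexes that are not void. *)
definition cohen_macaulay :: "'k::comm_ring_1 itself \<Rightarrow> 'a set set \<Rightarrow> bool" where
  "cohen_macaulay R K \<longleftrightarrow>
     (\<forall>\<sigma>\<in>K. \<forall>i < complex_dim (link K \<sigma>).
        trivial_group (reduced_homology (link K \<sigma>) i :: ('a list \<Rightarrow> 'k) set monoid))"

definition sequentially_cohen_macaulay :: "'k::comm_ring_1 itself \<Rightarrow> 'a set set \<Rightarrow> bool" where
  "sequentially_cohen_macaulay R K \<longleftrightarrow> (\<forall>d. cohen_macaulay R (pure_skeleton K d))"

end

theory Submission
  imports Defs
begin

text \<open>Let \<open>v\<close> be a simplicial vertex. The faces of \<open>I(C)\<close> outside the star of \<open>v\<close> are those containing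
  \<open>e - {v}\<close> for some circuit \<open>e\<close> through \<open>v\<close>, and simpliciality makes this \<open>e\<close> unique. So a
  shelling of the star, whose base \<open>I(C/v)\<close> is shellable by induction, extends by
  shellings of the links of the sets \<open>e - {v}\<close>, which come from contractions as well. The same
  argument applied to the faces of a fixed cardinality shells all pure skeleta. As the links of a
  pure skeleton of \<open>I(C)\<close> are pure skeleta of \<open>I(C/\<sigma>)\<close>, the Cohen-Macaulay property
  reduces to the vanishing of the homology below the top dimension of a pure shelled complex, which is
  checked facet by facet. A family is shelled in the sense used here if every new facet meets
  the earlier ones in a union of its codimension 1 faces.\<close>

section \<open>Shelled families of sets\<close>

inductive shelled :: "'a set set \<Rightarrow> bool" where
  shelled_empty: "shelled {}"
| shelled_insert: "\<lbrakk>shelled F; \<And>G. G \<in> F \<Longrightarrow> \<exists>w\<in>A - G. \<exists>H\<in>F. A - {w} \<subseteq> H\<rbrakk>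
    \<Longrightarrow> shelled (insert A F)"

text \<open>List \<open>F\<close> first, then the sets \<open>G \<union> \<sigma>\<close> in the
  order of \<open>B\<close>. Against an earlier member of \<open>F\<close> the last hypothesis
  supplies a vertex of \<open>\<sigma>\<close>; against an earlier
  \<open>G' \<union> \<sigma>\<close> the vertex from the shelling of \<open>B\<close> works, as it
  lies outside \<open>\<sigma>\<close>.\<close>

lemma shelled_union_block:
  assumes "shelled B" "shelled F"
    and "\<And>G. G \<in> B \<Longrightarrow> G \<inter> \<sigma> = {}"
    and "\<And>G H. \<lbrakk>G \<in> B; H \<in> F\<rbrakk> \<Longrightarrow> \<exists>w\<in>\<sigma> - H. \<exists>H'\<in>F. G \<union> \<sigma> - {w} \<subseteq> H'"
  shows "shelled (F \<union> (\<lambda>G. G \<union> \<sigma>) ` B)"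
  using assms
proof (induction B rule: shelled.induct)
  case shelled_empty
  then show ?case by simp
next
  case (shelled_insert B A)
  let ?F = "F \<union> (\<lambda>G. G \<union> \<sigma>) ` B"
  have IH: "shelled ?F"
    using shelled_insert.prems by (intro shelled_insert.IH) auto
  have "shelled (insert (A \<union> \<sigma>) ?F)"
  proof (rule shelled.shelled_insert[OF IH])
    fix G assume "G \<in> ?F"
    then consider "G \<in> F" | G' where "G' \<in> B" "G = G' \<union> \<sigma>" by blast
    then show "\<exists>w\<in>A \<union> \<sigma> - G. \<exists>H\<in>?F. A \<union> \<sigma> - {w} \<subseteq> H"
    proof cases
      case 1
      then obtain w H' where "w \<in> \<sigma> - G" "H' \<in> F" "A \<union> \<sigma> - {w} \<subseteq> H'"
        using shelled_insert.prems(3)[of A G] by auto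
      then show ?thesis by blast
    next
      case 2
      then obtain w H where "w \<in> A - G'" "H \<in> B" "A - {w} \<subseteq> H"
        using shelled_insert.hyps(2) by blast
      moreover have "w \<notin> \<sigma>"
        using \<open>w \<in> A - G'\<close> shelled_insert.prems(2)[of A] by auto
      ultimately show ?thesis
        using 2 by (intro bexI[of _ w] bexI[of _ "H \<union> \<sigma>"]) auto
    qed
  qed
  then show ?case by simp
qed

section \<open>From shelled families to shellable complexes\<close>

lemma shelled_imp_list:
  assumes "shelled F"
  shows "\<exists>s. distinct s \<and> set s = F \<and>
    (\<forall>i<length s. \<forall>G\<in>set (take i s). \<exists>w\<in>s ! i - G. \<exists>H\<in>set (take i s). s ! i - {w} \<subseteq> H)"
  using assms
proof (induction rule: shelled.induct)
  case shelled_empty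
  then show ?case by simp
next
  case (shelled_insert F A)
  then obtain s where s: "distinct s" "set s = F"
    and *: "\<And>i G. \<lbrakk>i < length s; G \<in> set (take i s)\<rbrakk>
      \<Longrightarrow> \<exists>w\<in>s ! i - G. \<exists>H\<in>set (take i s). s ! i - {w} \<subseteq> H"
    by blast
  \<comment> \<open>For \<open>G = A\<close> the condition would produce
    \<open>w \<in> A - A\<close>; hence the list stays distinct.\<close>
  have "A \<notin> F"
    using shelled_insert.hyps(2)[of A] by blast
  have "\<exists>w\<in>(s @ [A]) ! i - G. \<exists>H\<in>set (take i (s @ [A])). (s @ [A]) ! i - {w} \<subseteq> H"
    if "i < length (s @ [A])" "G \<in> set (take i (s @ [A]))" for i G
  proof (cases "i < length s")
    case True
    then show ?thesis
      using * that by (simp add: nth_append)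
  next
    case False
    then have "i = length s"
      using that by simp
    then show ?thesis
      using shelled_insert.hyps(2) s that by simp
  qed
  then show ?case
    using s \<open>A \<notin> F\<close> by (intro exI[of _ "s @ [A]"]) auto
qed

text \<open>A facet of the intersection lies in some earlier \<open>G\<close>, hence in a set
  \<open>s ! i - {w}\<close> that is itself in the intersection. Maximality makes the two
  equal.\<close>

lemma shellable_if_shelled_facets:
  assumes "shelled (facets K)" and fin: "\<And>\<sigma>. \<sigma> \<in> K \<Longrightarrow> finite \<sigma>"
  shows "shellable K"
proof -
  obtain s where s: "distinct s" "set s = facets K"
    and *: "\<And>i G. \<lbrakk>i < length s; G \<in> set (take i s)\<rbrakk>
      \<Longrightarrow> \<exists>w\<in>s ! i - G. \<exists>H\<in>set (take i s). s ! i - {w} \<subseteq> H"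
    using shelled_imp_list[OF assms(1)] by blast
  have "pure_of_dim (generated_complex {s ! i} \<inter> generated_complex (set (take i s)))
          (face_dim (s ! i) - 1)" if i: "0 < i" "i < length s" for i
  proof -
    let ?J = "generated_complex {s ! i} \<inter> generated_complex (set (take i s))"
    have "s ! i \<in> K"
      using s(2) nth_mem[OF i(2)] by (auto simp: facets_def)
    then have fin_i: "finite (s ! i)" by (rule fin)
    \<comment> \<open>Purity also demands that the intersection is not void.\<close>
    have "s ! 0 \<in> set (take i s)"
      using i by (metis length_take min.absorb4 nth_mem nth_take)
    then have "{} \<in> ?J"
      by (auto simp: generated_complex_def)
    moreover have "face_dim \<tau> = face_dim (s ! i) - 1" if "\<tau> \<in> facets ?J" for \<tau>
    proof -
      have "\<tau> \<subseteq> s ! i" and "\<exists>G\<in>set (take i s). \<tau> \<subseteq> G"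
        and max: "\<And>\<rho>. \<rho> \<in> ?J \<Longrightarrow> \<not> \<tau> \<subset> \<rho>"
        using that by (auto simp: facets_def generated_complex_def)
      then obtain w H where w: "w \<in> s ! i" "w \<notin> \<tau>" "H \<in> set (take i s)" "s ! i - {w} \<subseteq> H"
        using *[OF i(2)] by blast
      have "s ! i - {w} \<in> ?J"
        using w by (auto simp: generated_complex_def)
      then have "\<tau> = s ! i - {w}"
        using max[of "s ! i - {w}"] w \<open>\<tau> \<subseteq> s ! i\<close> by blast
      \<comment> \<open>This keeps the natural subtraction in \<open>card (s ! i) - 1\<close> from
        being truncated.\<close>
      moreover have "card (s ! i) \<ge> 1"
        using w(1) fin_i by (metis One_nat_def Suc_leI card_gt_0_iff empty_iff)
      ultimately show ?thesis
        using w(1) fin_i by (simp add: face_dim_def)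
    qed
    ultimately show ?thesis
      by (auto simp: pure_of_dim_def)
  qed
  then show ?thesis
    using s by (auto simp: shellable_def shelling_def)
qed

section \<open>Contractions and links\<close>

text \<open>Adding \<open>\<sigma>\<close> preserves proper inclusion between sets disjoint from
  \<open>\<sigma>\<close>. The right-hand side is the form in which links enter
  \<open>shelled_simplicial_vertex\<close>.\<close>

lemma facets_link:
  "facets (link K \<sigma>) = (\<lambda>F. F - \<sigma>) ` {F \<in> facets K. \<sigma> \<subseteq> F}" (is "?L = ?R")
proof (intro subset_antisym subsetI)
  fix G assume G: "G \<in> ?L"
  then have disj: "G \<inter> \<sigma> = {}" and mem: "G \<union> \<sigma> \<in> K"
    and max: "\<And>\<tau>. \<tau> \<in> link K \<sigma> \<Longrightarrow> \<not> G \<subset> \<tau>"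
    by (auto simp: facets_def link_def)
  have "\<not> G \<union> \<sigma> \<subset> \<tau>" if "\<tau> \<in> K" for \<tau>
  proof
    assume "G \<union> \<sigma> \<subset> \<tau>"
    moreover from this that have "\<tau> - \<sigma> \<in> link K \<sigma>"
      by (auto simp: link_def Un_absorb2)
    ultimately show False
      using max[of "\<tau> - \<sigma>"] disj by blast
  qed
  with mem have "G \<union> \<sigma> \<in> facets K"
    by (auto simp: facets_def)
  moreover have "G = G \<union> \<sigma> - \<sigma>"
    using disj by blast
  ultimately show "G \<in> ?R" by blast
next
  fix G assume "G \<in> ?R"
  then obtain F where F: "F \<in> K" "\<sigma> \<subseteq> F" "G = F - \<sigma>" and max: "\<And>\<tau>. \<tau> \<in> K \<Longrightarrow> \<not> F \<subset> \<tau>"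
    by (auto simp: facets_def)
  have "G \<in> link K \<sigma>"
    using F by (auto simp: link_def Un_absorb2)
  moreover have "\<not> G \<subset> \<tau>" if "\<tau> \<in> link K \<sigma>" for \<tau>
  proof
    assume "G \<subset> \<tau>"
    then have "F \<subset> \<tau> \<union> \<sigma>"
      using F that by (auto simp: link_def)
    then show False
      using max[of "\<tau> \<union> \<sigma>"] that by (simp add: link_def)
  qed
  ultimately show "G \<in> ?L"
    by (auto simp: facets_def)
qed

text \<open>The counterpart of \<open>facets_link\<close> for faces of fixed size; the form
  \<open>card \<sigma> + n\<close> avoids a truncated difference.\<close>

lemma link_card_faces:
  assumes "finite \<sigma>" and "\<And>F. F \<in> K \<Longrightarrow> finite F"
  shows "(\<lambda>F. F - \<sigma>) ` {F \<in> K. card F = card \<sigma> + n \<and> \<sigma> \<subseteq> F} = {F \<in> link K \<sigma>. card F = n}"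
    (is "?L = ?R")
proof (intro subset_antisym subsetI)
  fix G assume "G \<in> ?L"
  then show "G \<in> ?R"
    using assms by (auto simp: link_def Un_absorb2 card_Diff_subset)
next
  fix G assume G: "G \<in> ?R"
  then have "G \<inter> \<sigma> = {}" "G \<union> \<sigma> \<in> K" "card G = n"
    by (auto simp: link_def)
  moreover from this have "card (G \<union> \<sigma>) = card \<sigma> + n"
    using assms(1) assms(2)[of "G \<union> \<sigma>"] by (simp add: card_Un_disjoint)
  moreover have "G = G \<union> \<sigma> - \<sigma>"
    using \<open>G \<inter> \<sigma> = {}\<close> by blast
  ultimately show "G \<in> ?L" by blast
qed

lemma link_link:
  assumes "\<rho> \<inter> \<sigma> = {}"
  shows "link (link K \<sigma>) \<rho> = link K (\<rho> \<union> \<sigma>)"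
  using assms by (auto simp: link_def Un_assoc Int_Un_distrib Int_Un_distrib2)

lemma clutter_deletion: "clutter V C \<Longrightarrow> clutter (V - {v}) (deletion C v)"
  by (auto simp: clutter_def deletion_def)

lemma clutter_contraction: "clutter V C \<Longrightarrow> clutter (V - {v}) (contraction C v)"
  by (auto simp: clutter_def contraction_def)

text \<open>Since \<open>C\<close> is finite, every \<open>e - {v}\<close> contains a minimal one,
  so discarding the others does not change which sets contain a member. If \<open>{v}\<close> is a
  circuit, both sides are void.\<close>

lemma independence_complex_contraction:
  assumes "clutter V C" "v \<in> V"
  shows "independence_complex (V - {v}) (contraction C v) = link (independence_complex V C) {v}"
proof -
  have "finite C"
    using assms(1) finite_subset[of C "Pow V"] by (simp add: clutter_def)
  define S where "S = (\<lambda>e. e - {v}) ` C"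
  have fin: "finite S"
    unfolding S_def using \<open>finite C\<close> by simp
  have contr: "contraction C v = {f \<in> S. \<not> (\<exists>g\<in>S. g \<subset> f)}"
    by (simp add: contraction_def S_def)
  have iff: "(\<exists>f\<in>contraction C v. f \<subseteq> \<tau>) \<longleftrightarrow> (\<exists>e\<in>C. e \<subseteq> insert v \<tau>)" for \<tau>
  proof
    assume "\<exists>f\<in>contraction C v. f \<subseteq> \<tau>"
    then obtain e where "e \<in> C" "e - {v} \<subseteq> \<tau>"
      unfolding contr S_def by blast
    then show "\<exists>e\<in>C. e \<subseteq> insert v \<tau>" by blast
  next
    assume "\<exists>e\<in>C. e \<subseteq> insert v \<tau>"
    then obtain e where e: "e \<in> C" "e - {v} \<subseteq> \<tau>" by blast
    then have "e - {v} \<in> S"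
      unfolding S_def by blast
    from finite_has_minimal2[OF fin this] obtain f
      where f: "f \<in> S" "f \<subseteq> e - {v}" and min: "\<forall>g\<in>S. g \<subseteq> f \<longrightarrow> f = g"
      by (elim bexE conjE)
    have "f \<in> contraction C v"
      unfolding contr using f(1) min by blast
    then show "\<exists>f\<in>contraction C v. f \<subseteq> \<tau>"
      using f(2) e(2) by blast
  qed
  show ?thesis
    unfolding independence_complex_def link_def iff using assms(2) by auto
qed

section \<open>Minors and links of chordal clutters\<close>

lemma minor_trans:
  assumes "minor W D X E" "minor V C W D"
  shows "minor V C X E"
  using assms by (induction rule: minor.induct) (auto intro: minor.intros)

lemma chordal_minor: "\<lbrakk>chordal V C; minor V C W D\<rbrakk> \<Longrightarrow> chordal W D"
  unfolding chordal_def using minor_trans by blast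

lemma chordal_deletion: "\<lbrakk>chordal V C; v \<in> V\<rbrakk> \<Longrightarrow> chordal (V - {v}) (deletion C v)"
  by (rule chordal_minor) (auto intro: minor.intros)

lemma chordal_contraction: "\<lbrakk>chordal V C; v \<in> V\<rbrakk> \<Longrightarrow> chordal (V - {v}) (contraction C v)"
  by (rule chordal_minor) (auto intro: minor.intros)

text \<open>The vertices of \<open>\<sigma>\<close> are contracted one after the other, each
  contraction taking one more link.\<close>

lemma link_chordal:
  assumes "finite \<sigma>" "\<sigma> \<subseteq> V" "clutter V C" "chordal V C"
  shows "\<exists>D. clutter (V - \<sigma>) D \<and> chordal (V - \<sigma>) D \<and>
    independence_complex (V - \<sigma>) D = link (independence_complex V C) \<sigma>"
  using assms(1,2)
proof (induction \<sigma> rule: finite_induct)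
  case empty
  then show ?case
    using assms(3,4) by (auto simp: link_def)
next
  case (insert v \<sigma>)
  then obtain D where D: "clutter (V - \<sigma>) D" "chordal (V - \<sigma>) D"
    "independence_complex (V - \<sigma>) D = link (independence_complex V C) \<sigma>"
    by auto
  have v: "v \<in> V - \<sigma>"
    using insert by auto
  have "V - insert v \<sigma> = V - \<sigma> - {v}" by blast
  moreover have "link (link (independence_complex V C) \<sigma>) {v}
      = link (independence_complex V C) (insert v \<sigma>)"
    using insert.hyps by (subst link_link) auto
  ultimately show ?case
    using clutter_contraction[OF D(1)] chordal_contraction[OF D(2) v]
      independence_complex_contraction[OF D(1) v] D(3)
    by (intro exI[of _ "contraction D v"]) simp
qed

section \<open>Shelling along a simplicial vertex\<close>

text \<open>The antichain \<open>X\<close> of faces splits into the faces containing \<open>v\<close>, the other faces of the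
  star of \<open>v\<close>, and, for every circuit \<open>e\<close> through \<open>v\<close>, the faces containing \<open>e - {v}\<close>. Since \<open>v\<close>
  is simplicial no face contains two of the sets \<open>e - {v}\<close>, so removing an element of
  \<open>e - {v}\<close> from a face of the last kind yields a face of the star of \<open>v\<close>.\<close>

lemma shelled_simplicial_vertex:
  fixes V :: "'a set" and C :: "'a set set"
  defines "K \<equiv> independence_complex V C"
  assumes C: "clutter V C" and simp_v: "simplicial_vertex V C v"
    and X: "X \<subseteq> K"
    and anti: "\<And>F G. \<lbrakk>F \<in> X; G \<in> X; F \<subseteq> G\<rbrakk> \<Longrightarrow> F = G"
    and ext: "\<And>F w. \<lbrakk>F \<in> X; v \<notin> F; w \<in> F; insert v (F - {w}) \<in> K\<rbrakk>
      \<Longrightarrow> \<exists>H\<in>X. v \<in> H \<and> F - {w} \<subseteq> H"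
    and link_v: "shelled ((\<lambda>F. F - {v}) ` {F \<in> X. {v} \<subseteq> F})"
    and link_e: "\<And>e. \<lbrakk>e \<in> C; v \<in> e\<rbrakk>
      \<Longrightarrow> shelled ((\<lambda>F. F - (e - {v})) ` {F \<in> X. e - {v} \<subseteq> F})"
  shows "shelled X"
proof -
  have v: "v \<in> V"
    using simp_v by (simp add: simplicial_vertex_def)
  have finV: "finite V" and finC: "finite C"
    using C finite_subset[of C "Pow V"] by (simp_all add: clutter_def)
  have "finite K"
    using finV by (auto simp: K_def independence_complex_def)
  then have finX: "finite X"
    using X by (rule finite_subset[rotated])
  have down: "G \<in> K" if "F \<in> K" "G \<subseteq> F" for F G
    using that unfolding K_def independence_complex_def by blast
  have img: "(\<lambda>G. G \<union> \<sigma>) ` (\<lambda>F. F - \<sigma>) ` {F \<in> X. \<sigma> \<subseteq> F} = {F \<in> X. \<sigma> \<subseteq> F}" for \<sigma>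
  proof -
    have "(\<lambda>F. F - \<sigma> \<union> \<sigma>) ` {F \<in> X. \<sigma> \<subseteq> F} = (\<lambda>F. F) ` {F \<in> X. \<sigma> \<subseteq> F}"
      by (intro image_cong) auto
    then show ?thesis by (simp add: image_image)
  qed
  define A where "A = {F \<in> X. v \<in> F}"
  have "shelled ({} \<union> (\<lambda>G. G \<union> {v}) ` (\<lambda>F. F - {v}) ` {F \<in> X. {v} \<subseteq> F})"
    by (rule shelled_union_block[OF link_v shelled_empty]) auto
  then have A: "shelled A"
    unfolding img by (simp add: A_def)
  define M where "M = {F \<in> X. v \<notin> F \<and> insert v F \<in> K}"
  \<comment> \<open>The members of \<open>M\<close> can be added in any order: for
    \<open>F \<in> M\<close> and \<open>w \<in> F\<close>, \<open>ext\<close> puts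
    \<open>F - {w}\<close> into a member of \<open>A\<close>, and the antichain condition provides a
    \<open>w\<close> outside any given other member.\<close>
  have AN: "shelled (A \<union> N)" if "N \<subseteq> M" for N
  proof -
    have "finite N"
      using that by (rule finite_subset) (simp add: M_def finX)
    then show ?thesis
      using that
    proof (induction N rule: finite_induct)
      case empty
      then show ?case using A by simp
    next
      case (insert F N)
      then have F: "F \<in> X" "v \<notin> F" "insert v F \<in> K"
        by (auto simp: M_def)
      have "shelled (insert F (A \<union> N))"
      proof (rule shelled_insert)
        show "shelled (A \<union> N)" using insert by auto
        fix G assume G: "G \<in> A \<union> N"
        then have "G \<in> X" "G \<noteq> F"
          using insert F by (auto simp: A_def M_def)
        then obtain w where w: "w \<in> F - G"
          using anti[of F G] F(1) by blast
        then have "\<exists>H\<in>X. v \<in> H \<and> F - {w} \<subseteq> H"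
          using F by (intro ext) (auto intro: down[OF F(3)])
        with w show "\<exists>w\<in>F - G. \<exists>H\<in>A \<union> N. F - {w} \<subseteq> H"
          by (auto simp: A_def)
      qed
      then show ?case by simp
    qed
  qed
  define B where "B e = {F \<in> X. e - {v} \<subseteq> F}" for e
  let ?Cv = "{e \<in> C. v \<in> e}"
  have inK: "\<not> e \<subseteq> F" if "F \<in> K" "e \<in> C" for e F
    using that by (auto simp: K_def independence_complex_def)
  have unique: "e = e'"
    if "e \<in> ?Cv" "e' \<in> ?Cv" "F \<in> K" "e - {v} \<subseteq> F" "e' - {v} \<subseteq> F" for e e' F
  proof (rule ccontr)
    assume "e \<noteq> e'"
    then have "\<exists>e3\<in>C. e3 \<subseteq> e \<union> e' - {v}"
      using simp_v that(1,2) unfolding simplicial_vertex_def by simp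
    then obtain e3 where "e3 \<in> C" and e3: "e3 \<subseteq> e \<union> e' - {v}"
      by blast
    from e3 that(4,5) have "e3 \<subseteq> F" by blast
    then show False
      using inK[of F e3] that(3) \<open>e3 \<in> C\<close> by simp
  qed
  have E: "shelled (A \<union> M \<union> \<Union> (B ` E))" if "E \<subseteq> ?Cv" for E
  proof -
    have "finite E"
      using that by (rule finite_subset) (simp add: finC)
    then show ?thesis
      using that
    proof (induction E rule: finite_induct)
      case empty
      then show ?case using AN[of M] by simp
    next
      case (insert e E)
      let ?F = "A \<union> M \<union> \<Union> (B ` E)"
      have e: "e \<in> C" "v \<in> e"
        using insert by auto
      have "shelled (?F \<union> (\<lambda>G. G \<union> (e - {v})) ` (\<lambda>F. F - (e - {v})) ` {F \<in> X. e - {v} \<subseteq> F})"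
      proof (rule shelled_union_block[OF link_e[OF e]])
        show "shelled ?F" using insert by auto
        fix G H assume G: "G \<in> (\<lambda>F. F - (e - {v})) ` {F \<in> X. e - {v} \<subseteq> F}" and H: "H \<in> ?F"
        then obtain F where F: "F \<in> X" "e - {v} \<subseteq> F" "G \<union> (e - {v}) = F"
          by auto
        have vF: "v \<notin> F"
          using inK[of F e] F(1,2) e X by blast
        have HX: "H \<in> X"
          using H by (auto simp: A_def M_def B_def)
        \<comment> \<open>Otherwise \<open>H\<close> or \<open>insert v H\<close> would be a face
          containing \<open>e\<close>, or \<open>H\<close> would lie over two circuits through
          \<open>v\<close>.\<close>
        have "\<not> e - {v} \<subseteq> H"
        proof
          assume sub: "e - {v} \<subseteq> H"
          from H consider "v \<in> H" | "insert v H \<in> K" | e' where "e' \<in> E" "e' - {v} \<subseteq> H"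
            by (auto simp: A_def M_def B_def)
          then show False
          proof cases
            case 1
            then show False using inK[of H e] sub e HX X by blast
          next
            case 2
            then show False using inK[of "insert v H" e] sub e by blast
          next
            case 3
            then have "e = e'"
              using unique[of e e' H] insert.prems sub HX X by auto
            then show False using 3 insert.hyps by simp
          qed
        qed
        then obtain w where w: "w \<in> e - {v} - H" by blast
        \<comment> \<open>A circuit inside this set must pass through \<open>v\<close>, because
          \<open>F\<close> is a face; by uniqueness it is \<open>e\<close>, but
          \<open>w \<in> e\<close> has been removed.\<close>
        have "insert v (F - {w}) \<in> K"
        proof -
          have "\<not> e' \<subseteq> insert v (F - {w})" if "e' \<in> C" for e'
          proof
            assume sub: "e' \<subseteq> insert v (F - {w})"
            have "v \<in> e'"
              using sub inK[of F e'] that F(1) X by blast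
            then have "e = e'"
              using unique[of e e' F] e that F sub X by blast
            then show False
              using sub w by blast
          qed
          moreover have "insert v (F - {w}) \<subseteq> V"
            using F(1) X v by (auto simp: K_def independence_complex_def)
          ultimately show ?thesis
            by (auto simp: K_def independence_complex_def)
        qed
        then obtain H' where "H' \<in> X" "v \<in> H'" "F - {w} \<subseteq> H'"
          using ext[of F w] F(1,2) vF w by blast
        then show "\<exists>w\<in>e - {v} - H. \<exists>H'\<in>?F. G \<union> (e - {v}) - {w} \<subseteq> H'"
          using w F(3) by (auto simp: A_def)
      qed auto
      then show ?case
        unfolding img B_def by (simp add: Un_commute Un_left_commute)
    qed
  qed
  have "X \<subseteq> A \<union> M \<union> \<Union> (B ` ?Cv)"
  proof
    fix F assume F: "F \<in> X"
    show "F \<in> A \<union> M \<union> \<Union> (B ` ?Cv)"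
    proof (cases "v \<in> F \<or> insert v F \<in> K")
      case True
      then show ?thesis using F by (auto simp: A_def M_def)
    next
      case False
      then obtain e where "e \<in> C" "e \<subseteq> insert v F"
        using F X v by (auto simp: K_def independence_complex_def)
      then have "e \<in> ?Cv" "F \<in> B e"
        using inK[of F e] F X by (auto simp: B_def)
      then show ?thesis by blast
    qed
  qed
  moreover have "A \<union> M \<union> \<Union> (B ` ?Cv) \<subseteq> X"
    by (auto simp: A_def M_def B_def)
  ultimately have "X = A \<union> M \<union> \<Union> (B ` ?Cv)" by (rule subset_antisym)
  then show ?thesis using E[of ?Cv] by simp
qed

section \<open>Induction on the number of vertices\<close>

lemma exists_facet_above:
  assumes "finite K" "\<sigma> \<in> K"
  shows "\<exists>F\<in>facets K. \<sigma> \<subseteq> F"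
  using finite_has_maximal2[OF assms] by (auto simp: facets_def)

text \<open>Both claims are instances of \<open>shelled_simplicial_vertex\<close>, with
  \<open>X\<close> the facets or the faces of size \<open>n\<close>; the links required there belong
  to chordal clutters on fewer vertices.\<close>

theorem shelled_chordal:
  assumes "clutter V C" "chordal V C"
  shows "shelled (facets (independence_complex V C)) \<and>
    (\<forall>n. shelled {F \<in> independence_complex V C. card F = n})"
  using assms
proof (induction "card V" arbitrary: V C rule: less_induct)
  case less
  let ?K = "independence_complex V C"
  have finV: "finite V"
    using less.prems by (simp add: clutter_def)
  have finF: "finite F" if "F \<in> ?K" for F
    using that finV finite_subset[of F V] by (simp add: independence_complex_def)
  have finK: "finite ?K"
    using finV by (auto simp: independence_complex_def)
  show ?case
  proof (cases "V = {}")
    case True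
    have "shelled {{}::'a set}"
      using shelled_insert[OF shelled_empty] by blast
    then have "shelled Y" if "Y \<subseteq> {{}}" for Y :: "'a set set"
      using that subset_singletonD[OF that] shelled_empty by auto
    \<comment> \<open>Only inclusions hold here: the complex is void if \<open>{}\<close> is a
      circuit.\<close>
    moreover have "facets ?K \<subseteq> {{}}" "\<And>n. {F \<in> ?K. card F = n} \<subseteq> {{}}"
      using True by (auto simp: facets_def independence_complex_def)
    ultimately show ?thesis by blast
  next
    case False
    then obtain v where sv: "simplicial_vertex V C v"
      using less.prems(2) minor_refl[of V C] unfolding chordal_def by blast
    then have v: "v \<in> V"
      by (simp add: simplicial_vertex_def)
    show ?thesis
    \<comment> \<open>If \<open>{v}\<close> is a circuit, no face contains \<open>v\<close> and
      deleting \<open>v\<close> leaves the complex unchanged. Otherwise every \<open>e - {v}\<close>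
      is nonempty, so its link has a smaller vertex set.\<close>
    proof (cases "{v} \<in> C")
      case True
      have "?K = independence_complex (V - {v}) (deletion C v)"
        using True by (auto simp: independence_complex_def deletion_def)
      moreover have "card (V - {v}) < card V"
        using v finV by (rule card_Diff1_less[rotated])
      ultimately show ?thesis
        using less.hyps[OF _ clutter_deletion[OF less.prems(1)] chordal_deletion[OF less.prems(2) v]]
        by simp
    next
      case noloop: False
      have IH: "shelled (facets (link ?K \<sigma>)) \<and> (\<forall>n. shelled {F \<in> link ?K \<sigma>. card F = n})"
        if "\<sigma> \<noteq> {}" "\<sigma> \<subseteq> V" for \<sigma>
      proof -
        have "finite \<sigma>"
          using \<open>\<sigma> \<subseteq> V\<close> finV by (rule finite_subset)
        then obtain D where "clutter (V - \<sigma>) D" "chordal (V - \<sigma>) D"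
          "independence_complex (V - \<sigma>) D = link ?K \<sigma>"
          using link_chordal[OF _ \<open>\<sigma> \<subseteq> V\<close> less.prems] by blast
        moreover have "card (V - \<sigma>) < card V"
          using that finV by (intro psubset_card_mono) auto
        ultimately show ?thesis
          using less.hyps[of "V - \<sigma>" D] by simp
      qed
      have circ: "e - {v} \<noteq> {} \<and> e - {v} \<subseteq> V" if "e \<in> C" "v \<in> e" for e
        using that noloop less.prems(1) subset_singletonD[of e v] by (auto simp: clutter_def)
      have "shelled (facets ?K)"
      proof (rule shelled_simplicial_vertex[OF less.prems(1) sv])
        fix F w assume "insert v (F - {w}) \<in> ?K"
        from exists_facet_above[OF finK this]
        show "\<exists>H\<in>facets ?K. v \<in> H \<and> F - {w} \<subseteq> H" by auto
      next
        show "shelled ((\<lambda>F. F - {v}) ` {F \<in> facets ?K. {v} \<subseteq> F})"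
          unfolding facets_link[symmetric] using IH[of "{v}"] v by simp
      next
        fix e assume "e \<in> C" "v \<in> e"
        from circ[OF this] show "shelled ((\<lambda>F. F - (e - {v})) ` {F \<in> facets ?K. e - {v} \<subseteq> F})"
          unfolding facets_link[symmetric] using IH[of "e - {v}"] by simp
      next
        show "F = G" if "F \<in> facets ?K" "G \<in> facets ?K" "F \<subseteq> G" for F G
          using that by (auto simp: facets_def)
      qed (simp add: facets_def)
      moreover have "shelled {F \<in> ?K. card F = n}" for n
      proof -
        have lk: "shelled ((\<lambda>F. F - \<sigma>) ` {F \<in> {F \<in> ?K. card F = n}. \<sigma> \<subseteq> F})"
          if \<sigma>: "\<sigma> \<noteq> {}" "\<sigma> \<subseteq> V" for \<sigma>
        proof (cases "card \<sigma> \<le> n")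
          case True
          then obtain m where m: "n = card \<sigma> + m"
            using le_Suc_ex by blast
          have "finite \<sigma>" using \<sigma>(2) finV finite_subset by blast
          from link_card_faces[OF this, of ?K m] finF IH[OF \<sigma>] show ?thesis
            by (simp add: m)
        next
          case False
          then have "{F \<in> {F \<in> ?K. card F = n}. \<sigma> \<subseteq> F} = {}"
            using card_mono[OF finF] by fastforce
          then show ?thesis using shelled_empty by (metis image_empty)
        qed
        show ?thesis
        proof (rule shelled_simplicial_vertex[OF less.prems(1) sv])
          fix F G assume "F \<in> {F \<in> ?K. card F = n}" "G \<in> {F \<in> ?K. card F = n}" "F \<subseteq> G"
          then show "F = G"
            using finF by (simp add: card_subset_eq)
        next
          fix F w assume "F \<in> {F \<in> ?K. card F = n}" "v \<notin> F" "w \<in> F" "insert v (F - {w}) \<in> ?K"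
          \<comment> \<open>Exchanging \<open>w\<close> for \<open>v\<close> keeps the size, so the
            exchanged face itself serves as \<open>H\<close>.\<close>
          moreover from this have "card (insert v (F - {w})) = n"
            using finF[of F] card_Suc_Diff1[of F w] by simp
          ultimately show "\<exists>H\<in>{F \<in> ?K. card F = n}. v \<in> H \<and> F - {w} \<subseteq> H"
            by blast
        next
          show "shelled ((\<lambda>F. F - {v}) ` {F \<in> {F \<in> ?K. card F = n}. {v} \<subseteq> F})"
            using v by (intro lk) auto
        next
          fix e assume "e \<in> C" "v \<in> e"
          then show "shelled ((\<lambda>F. F - (e - {v})) ` {F \<in> {F \<in> ?K. card F = n}. e - {v} \<subseteq> F})"
            using circ by (intro lk) auto
        qed simp
      qed
      ultimately show ?thesis by blast
    qed
  qed
qed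

section \<open>Boundaries of oriented chains\<close>

text \<open>\<open>boundary K\<close> sums over the vertices of \<open>K\<close>. A fixed
  \<open>U\<close> gives one operator for all complexes on \<open>U\<close>, so a complex can grow
  during an induction.\<close>

definition vertex_boundary :: "'a set \<Rightarrow> ('a list \<Rightarrow> 'k::comm_ring_1) \<Rightarrow> 'a list \<Rightarrow> 'k" where
  "vertex_boundary U c = (\<lambda>xs. \<Sum>v\<in>U. c (v # xs))"

lemma boundary_eq_vertex_boundary: "boundary K c = vertex_boundary (\<Union>K) c"
  by (simp add: boundary_def vertex_boundary_def)

lemma vertex_boundary_add:
  "vertex_boundary U (\<lambda>xs. c xs + d xs) = (\<lambda>xs. vertex_boundary U c xs + vertex_boundary U d xs)"
  by (simp add: vertex_boundary_def sum.distrib)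

lemma vertex_boundary_uminus:
  "vertex_boundary U (\<lambda>xs. - c xs) = (\<lambda>xs. - vertex_boundary U c xs)"
  by (simp add: vertex_boundary_def sum_negf)

lemma chain_supportD:
  assumes "chain K i c" "c xs \<noteq> 0"
  shows "distinct xs" "set xs \<in> K" "face_dim (set xs) = i"
  using assms unfolding chain_def by blast+

lemma chain_swap: "chain K i c \<Longrightarrow> c (xs @ y # x # ys) = - c (xs @ x # y # ys)"
  unfolding chain_def by blast

lemma chain_swap_Cons: "chain K i c \<Longrightarrow> c (y # x # ys) = - c (x # y # ys)"
  using chain_swap[of K i c "[]" y x ys] by simp

lemma chain_zero: "chain K i (\<lambda>_. 0)"
  by (simp add: chain_def)

lemma chain_add:
  assumes "chain K i c" "chain K i d"
  shows "chain K i (\<lambda>xs. c xs + d xs)"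
  unfolding chain_def
proof (intro conjI allI impI)
  fix xs assume "c xs + d xs \<noteq> 0"
  then have "c xs \<noteq> 0 \<or> d xs \<noteq> 0" by auto
  then show "distinct xs" "set xs \<in> K" "face_dim (set xs) = i"
    using chain_supportD[OF assms(1)] chain_supportD[OF assms(2)] by blast+
next
  fix xs x y ys
  show "c (xs @ y # x # ys) + d (xs @ y # x # ys) = - (c (xs @ x # y # ys) + d (xs @ x # y # ys))"
    using chain_swap[OF assms(1), of xs y x ys] chain_swap[OF assms(2), of xs y x ys] by simp
qed

lemma chain_uminus: "chain K i c \<Longrightarrow> chain K i (\<lambda>xs. - c xs)"
  unfolding chain_def by (metis neg_equal_0_iff_equal)

lemma chain_mono: "\<lbrakk>chain K i c; K \<subseteq> L\<rbrakk> \<Longrightarrow> chain L i c"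
  unfolding chain_def by blast

text \<open>Moving \<open>u\<close> to the front changes only the sign; asking about vanishing
  spares computing it.\<close>

lemma chain_eq_0_move:
  assumes "chain K i c"
  shows "c (xs @ u # ys) = 0 \<longleftrightarrow> c (u # xs @ ys) = 0"
proof (induction xs arbitrary: ys rule: rev_induct)
  case (snoc x xs)
  have "c ((xs @ [x]) @ u # ys) = - c (xs @ u # x # ys)"
    using chain_swap[OF assms, of xs x u ys] by simp
  then show ?case
    using snoc[of "x # ys"] by simp
qed simp

lemma chain_vertex_boundary:
  assumes c: "chain K i c" and down: "\<And>\<sigma> \<tau>. \<lbrakk>\<sigma> \<in> K; \<tau> \<subseteq> \<sigma>\<rbrakk> \<Longrightarrow> \<tau> \<in> K"
  shows "chain K (i - 1) (vertex_boundary U c)"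
  unfolding chain_def
proof (intro conjI allI impI)
  fix xs assume "vertex_boundary U c xs \<noteq> 0"
  then obtain v where "c (v # xs) \<noteq> 0"
    unfolding vertex_boundary_def by (meson sum.not_neutral_contains_not_neutral)
  from chain_supportD[OF c this] show "distinct xs" "set xs \<in> K" "face_dim (set xs) = i - 1"
    using down[of "set (v # xs)" "set xs"] by (auto simp: face_dim_def)
next
  fix xs x y ys
  have "c (v # xs @ y # x # ys) = - c (v # xs @ x # y # ys)" for v
    using chain_swap[OF c, of "v # xs" y x ys] by simp
  then show "vertex_boundary U c (xs @ y # x # ys) = - vertex_boundary U c (xs @ x # y # ys)"
    by (simp add: vertex_boundary_def sum_negf)
qed

text \<open>The diagonal has to vanish separately, as 2 may be a zero divisor.\<close>

lemma sum_sum_alternating: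
  fixes f :: "'a \<Rightarrow> 'a \<Rightarrow> 'b::ab_group_add"
  assumes "finite U" "\<And>v. f v v = 0" "\<And>v w. f w v = - f v w"
  shows "(\<Sum>v\<in>U. \<Sum>w\<in>U. f v w) = 0"
  using assms(1)
proof (induction U rule: finite_induct)
  case (insert a U)
  have "(\<Sum>v\<in>U. f v a) = - (\<Sum>w\<in>U. f a w)"
    by (simp add: assms(3)[of a] sum_negf)
  then show ?case
    using insert by (simp add: sum.distrib assms(2))
qed simp

text \<open>The two orders of a pair of added vertices cancel, and a list with a repeated vertex has
  coefficient 0.\<close>

lemma vertex_boundary_vertex_boundary:
  assumes "chain K i c" "finite U"
  shows "vertex_boundary U (vertex_boundary U c) = (\<lambda>_. 0)"
proof
  fix xs
  have "c (v # v # xs) = 0" for v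
    using chain_supportD(1)[OF assms(1), of "v # v # xs"] by auto
  then have "(\<Sum>v\<in>U. \<Sum>w\<in>U. c (w # v # xs)) = 0"
    by (rule sum_sum_alternating[OF assms(2) _ chain_swap_Cons[OF assms(1)]])
  then show "vertex_boundary U (vertex_boundary U c) xs = 0"
    by (simp add: vertex_boundary_def)
qed

text \<open>On a simplex containing \<open>u\<close>, the cone takes the coefficient of \<open>z\<close> at the opposite face
  of \<open>u\<close>, with the sign of the permutation that moves \<open>u\<close> to the front.\<close>

primrec cone :: "'a \<Rightarrow> ('a list \<Rightarrow> 'k::comm_ring_1) \<Rightarrow> 'a list \<Rightarrow> 'k" where
  "cone u z [] = 0"
| "cone u z (x # xs) = (if x = u then z xs else - cone u (\<lambda>ys. z (x # ys)) xs)"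

lemma cone_uminus: "cone u (\<lambda>ys. - z ys) xs = - cone u z xs"
  by (induction xs arbitrary: z) auto

text \<open>If \<open>u\<close> is one of the swapped entries, its position shifts by one and the
  sign in \<open>cone\<close> flips; otherwise the sign comes from \<open>z\<close>. The case
  \<open>x = y = u\<close> is excluded because there \<open>cone\<close> reads
  \<open>z (u # qs)\<close>.\<close>

lemma cone_swap:
  assumes "\<And>ps x y qs. z (ps @ y # x # qs) = - z (ps @ x # y # qs)" "x \<noteq> y"
  shows "cone u z (ps @ y # x # qs) = - cone u z (ps @ x # y # qs)"
  using assms(1)
proof (induction ps arbitrary: z)
  case Nil
  have "z (y # x # ys) = - z (x # y # ys)" for ys
    using Nil[of "[]" x y ys] by simp
  then have "cone u (\<lambda>ys. z (y # x # ys)) qs = - cone u (\<lambda>ys. z (x # y # ys)) qs"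
    by (simp add: cone_uminus)
  then show ?case
    using assms(2) by auto
next
  case (Cons p ps)
  have "cone u (\<lambda>ys. z (p # ys)) (ps @ y # x # qs) = - cone u (\<lambda>ys. z (p # ys)) (ps @ x # y # qs)"
  proof (rule Cons.IH)
    fix ps' qs' x' y'
    show "z (p # ps' @ y' # x' # qs') = - z (p # ps' @ x' # y' # qs')"
      using Cons.prems[of "p # ps'" x' y' qs'] by simp
  qed
  then show ?case
    using Cons.prems[of ps x y qs] by simp
qed

section \<open>Vanishing homology of shelled families\<close>

text \<open>This expresses vanishing \<open>i\<close>-th homology without quotient groups, with the
  boundary taken over a fixed \<open>U\<close>.\<close>

definition exact_at :: "'k::comm_ring_1 itself \<Rightarrow> 'a set \<Rightarrow> 'a set set \<Rightarrow> int \<Rightarrow> bool" where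
  "exact_at R U K i \<longleftrightarrow> (\<forall>z :: 'a list \<Rightarrow> 'k.
     chain K i z \<and> vertex_boundary U z = (\<lambda>_. 0) \<longrightarrow>
     (\<exists>y. chain K (i + 1) y \<and> vertex_boundary U y = z))"

text \<open>The simplices of \<open>A\<close> missing from \<open>K\<close> are those containing \<open>R\<close>. If \<open>R \<noteq> A\<close>, pick \<open>u\<close> in
  \<open>A - R\<close>; subtracting from a cycle the boundary of the cone with apex \<open>u\<close> over its part on the
  missing simplices that avoid \<open>u\<close> pushes the cycle into \<open>K\<close>.\<close>

lemma exact_at_add_simplex:
  assumes U: "finite U" "A \<subseteq> U" and "R \<subseteq> A"
    and new: "\<And>\<tau>. \<tau> \<subseteq> A \<Longrightarrow> \<tau> \<in> K \<longleftrightarrow> \<not> R \<subseteq> \<tau>"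
    and down: "\<And>\<sigma> \<tau>. \<lbrakk>\<sigma> \<in> K; \<tau> \<subseteq> \<sigma>\<rbrakk> \<Longrightarrow> \<tau> \<in> K"
    and dim: "i < face_dim A"
    and exact: "exact_at TYPE('k::comm_ring_1) U K i"
  shows "exact_at TYPE('k) U (K \<union> Pow A) i"
  unfolding exact_at_def
proof (intro allI impI, elim conjE)
  let ?K = "K \<union> Pow A"
  have down': "\<tau> \<in> ?K" if "\<sigma> \<in> ?K" "\<tau> \<subseteq> \<sigma>" for \<sigma> \<tau>
    using that down[of \<sigma> \<tau>] by blast
  fix z :: "'a list \<Rightarrow> 'k"
  assume z: "chain ?K i z" and bz: "vertex_boundary U z = (\<lambda>_. 0)"
  have push: "chain K i c"
    if c: "chain ?K i c" and "\<And>xs. \<lbrakk>R \<subseteq> set xs; set xs \<subseteq> A\<rbrakk> \<Longrightarrow> c xs = 0" for c :: "'a list \<Rightarrow> 'k"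
    unfolding chain_def
  proof (intro conjI allI impI)
    fix xs assume nz: "c xs \<noteq> 0"
    show "distinct xs" "face_dim (set xs) = i"
      using chain_supportD[OF c nz] by auto
    show "set xs \<in> K"
      using chain_supportD(2)[OF c nz] that(2)[of xs] nz new[of "set xs"] by blast
  qed (rule chain_swap[OF c])
  show "\<exists>y. chain ?K (i + 1) y \<and> vertex_boundary U y = z"
  proof (cases "R = A")
    case True
    \<comment> \<open>Here \<open>A\<close> is the only new simplex, and its dimension exceeds
      \<open>i\<close>.\<close>
    have "z xs = 0" if "R \<subseteq> set xs" "set xs \<subseteq> A" for xs
    proof (rule ccontr)
      assume "z xs \<noteq> 0"
      then have "face_dim (set xs) = i"
        using chain_supportD[OF z] by blast
      moreover have "set xs = A" using True that by blast
      ultimately show False using dim by simp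
    qed
    then have "chain K i z"
      by (rule push[OF z])
    then obtain y where "chain K (i + 1) y" "vertex_boundary U y = z"
      using exact bz unfolding exact_at_def by blast
    then show ?thesis
      using chain_mono[of K "i + 1" y ?K] by blast
  next
    case False
    then obtain u where u: "u \<in> A" "u \<notin> R"
      using \<open>R \<subseteq> A\<close> by blast
    \<comment> \<open>The guard keeps only the part of the cone on simplices of \<open>A\<close>
      that contain both \<open>u\<close> and \<open>R\<close>; their faces opposite \<open>u\<close>
      are missing from \<open>K\<close>.\<close>
    define y where "y xs = (if distinct xs \<and> set xs \<subseteq> A \<and> insert u R \<subseteq> set xs \<and>
      face_dim (set xs) = i + 1 then cone u z xs else 0)" for xs
    have y: "chain ?K (i + 1) y"
      unfolding chain_def
    proof (intro conjI allI impI)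
      fix ps qs :: "'a list" and a b
      have sets: "set (ps @ b # a # qs) = set (ps @ a # b # qs)"
        and dist: "distinct (ps @ b # a # qs) \<longleftrightarrow> distinct (ps @ a # b # qs)"
        by auto
      show "y (ps @ b # a # qs) = - y (ps @ a # b # qs)"
      proof (cases "distinct (ps @ a # b # qs)")
        case True
        then have "cone u z (ps @ b # a # qs) = - cone u z (ps @ a # b # qs)"
          by (intro cone_swap chain_swap[OF z]) auto
        then show ?thesis
          unfolding y_def sets dist by auto
      next
        case False
        then have "\<not> distinct (ps @ b # a # qs)"
          using dist by blast
        with False show ?thesis
          unfolding y_def by (simp only: simp_thms if_False minus_zero)
      qed
    qed (auto simp: y_def split: if_splits)
    define z' where "z' xs = z xs + - vertex_boundary U y xs" for xs
    have by': "chain ?K i (vertex_boundary U y)"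
      using chain_vertex_boundary[OF y down', where U = U] by simp
    have z': "chain ?K i z'"
      unfolding z'_def by (intro chain_add z chain_uminus by')
    have bz': "vertex_boundary U z' = (\<lambda>_. 0)"
      unfolding z'_def vertex_boundary_add vertex_boundary_uminus
      by (simp add: bz vertex_boundary_vertex_boundary[OF y U(1)])
    have avoid: "z' xs = 0" if xs: "R \<subseteq> set xs" "set xs \<subseteq> A" "u \<notin> set xs" for xs
    proof (rule ccontr)
      assume nz: "z' xs \<noteq> 0"
      \<comment> \<open>For \<open>v \<noteq> u\<close> the list \<open>v # xs\<close> misses
        \<open>u\<close> and fails the guard; for \<open>v = u\<close> the cone returns
        \<open>z xs\<close>.\<close>
      have "vertex_boundary U y xs = (\<Sum>v\<in>U. if v = u then z xs else 0)"
        unfolding vertex_boundary_def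
      proof (rule sum.cong[OF refl])
        fix v
        show "y (v # xs) = (if v = u then z xs else 0)"
          using xs u(1) chain_supportD[OF z' nz] by (auto simp: y_def face_dim_def)
      qed
      also have "\<dots> = z xs"
        using U u(1) by auto
      finally show False
        using nz by (simp add: z'_def)
    qed
    have zero: "z' xs = 0" if xs: "R \<subseteq> set xs" "set xs \<subseteq> A" for xs
    proof (rule ccontr)
      assume nz: "z' xs \<noteq> 0"
      then have "u \<in> set xs"
        using avoid xs by blast
      then obtain ps qs where split: "xs = ps @ u # qs"
        by (meson split_list)
      have dist: "distinct (ps @ u # qs)"
        using chain_supportD(1)[OF z' nz] split by simp
      have nz': "z' (u # ps @ qs) \<noteq> 0"
        using nz chain_eq_0_move[OF z', of ps u qs] split by simp
      \<comment> \<open>The vanishing boundary of \<open>z'\<close> is evaluated at the face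
        opposite \<open>u\<close>. That face still contains \<open>R\<close>, so every other simplex
        over it is either outside the complex or a new one avoiding \<open>u\<close>, where
        \<open>z'\<close> is 0. Only the term of \<open>u\<close> is left.\<close>
      have ys: "R \<subseteq> set (ps @ qs)" "set (ps @ qs) \<subseteq> A"
        using xs split u(2) by auto
      have "z' (v # ps @ qs) = 0" if "v \<noteq> u" for v
      proof (rule ccontr)
        assume nzv: "z' (v # ps @ qs) \<noteq> 0"
        have "set (v # ps @ qs) \<notin> K"
          using down[of "set (v # ps @ qs)" "set (ps @ qs)"] new[OF ys(2)] ys(1) by auto
        then have "set (v # ps @ qs) \<subseteq> A"
          using chain_supportD(2)[OF z' nzv] by blast
        then show False
          using avoid[of "v # ps @ qs"] nzv ys(1) dist that by auto
      qed
      then have "vertex_boundary U z' (ps @ qs) = (\<Sum>v\<in>U. if v = u then z' (u # ps @ qs) else 0)"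
        unfolding vertex_boundary_def by (intro sum.cong) auto
      also have "\<dots> = z' (u # ps @ qs)"
        using U u(1) by auto
      finally show False
        using bz' nz' by simp
    qed
    then have "chain K i z'"
      by (rule push[OF z'])
    then obtain y' where y': "chain K (i + 1) y'" "vertex_boundary U y' = z'"
      using exact bz' unfolding exact_at_def by blast
    have "chain ?K (i + 1) (\<lambda>xs. y' xs + y xs)"
      using chain_mono[OF y'(1), of ?K] y by (intro chain_add) auto
    moreover have "vertex_boundary U (\<lambda>xs. y' xs + y xs) = z"
      by (simp add: vertex_boundary_add y'(2) z'_def)
    ultimately show ?thesis by blast
  qed
qed

text \<open>The induction starts from the void complex, which has only the zero chain, and adds one
  facet at a time by \<open>exact_at_add_simplex\<close>.\<close>

lemma exact_at_shelled:
  assumes "shelled X" "finite U" "\<And>F. F \<in> X \<Longrightarrow> F \<subseteq> U \<and> i < face_dim F"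
  shows "exact_at TYPE('k::comm_ring_1) U (generated_complex X) i"
  using assms(1,3)
proof (induction rule: shelled.induct)
  case shelled_empty
  have "z = (\<lambda>_. 0)" if "chain {} i z" for z :: "'a list \<Rightarrow> 'k"
    using chain_supportD(2)[OF that] by blast
  then show ?case
    by (auto simp: exact_at_def generated_complex_def vertex_boundary_def
        intro!: exI[of _ "\<lambda>_. 0"] chain_zero)
next
  case (shelled_insert F A)
  let ?K = "generated_complex F"
  \<comment> \<open>This is the restriction of \<open>A\<close> in the shelling, the least face of
    \<open>A\<close> that is new.\<close>
  define R where "R = {w \<in> A. A - {w} \<in> ?K}"
  have "exact_at TYPE('k) U (?K \<union> Pow A) i"
  proof (rule exact_at_add_simplex[where R = R])
    fix \<tau> assume \<tau>: "\<tau> \<subseteq> A"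
    show "\<tau> \<in> ?K \<longleftrightarrow> \<not> R \<subseteq> \<tau>"
    proof
      assume "\<tau> \<in> ?K"
      then obtain G where G: "G \<in> F" "\<tau> \<subseteq> G"
        by (auto simp: generated_complex_def)
      then obtain w H where "w \<in> A - G" "H \<in> F" "A - {w} \<subseteq> H"
        using shelled_insert.hyps(2) by blast
      then have "w \<in> R" "w \<notin> \<tau>"
        using G by (auto simp: R_def generated_complex_def)
      then show "\<not> R \<subseteq> \<tau>" by blast
    next
      assume "\<not> R \<subseteq> \<tau>"
      then obtain w where "A - {w} \<in> ?K" "w \<notin> \<tau>"
        by (auto simp: R_def)
      moreover from this \<tau> have "\<tau> \<subseteq> A - {w}" by blast
      ultimately show "\<tau> \<in> ?K"
        unfolding generated_complex_def by blast
    qed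
  next
    show "exact_at TYPE('k) U ?K i"
      using shelled_insert.IH shelled_insert.prems by auto
  next
    fix \<sigma> \<tau> assume "\<sigma> \<in> ?K" "\<tau> \<subseteq> \<sigma>"
    then show "\<tau> \<in> ?K"
      unfolding generated_complex_def by blast
  qed (use assms(2) shelled_insert.prems in \<open>auto simp: R_def\<close>)
  moreover have "generated_complex (insert A F) = ?K \<union> Pow A"
    by (auto simp: generated_complex_def)
  ultimately show ?case by simp
qed

section \<open>From exactness to trivial reduced homology groups\<close>

lemma trivial_group_Mod_carrier:
  assumes "comm_group G"
  shows "trivial_group (G Mod carrier G)"
proof -
  interpret comm_group G by fact
  have sub: "subgroup (carrier G) G"
    by (rule subgroup_self)
  then have "carrier G \<lhd> G"
    by (rule subgroup_imp_normal)
  then have "group (G Mod carrier G)"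
    by (rule normal.factorgroup_is_group)
  moreover have "carrier (G Mod carrier G) = {carrier G}"
    using coset_join2[OF _ sub] one_closed by (auto simp: FactGroup_def RCOSETS_def)
  ultimately show ?thesis
    by (simp add: trivial_group_def FactGroup_def)
qed

lemma cycle_iff: "c \<in> cycles K i \<longleftrightarrow> chain K i c \<and> vertex_boundary (\<Union>K) c = (\<lambda>_. 0)"
  by (simp add: cycles_def boundary_eq_vertex_boundary)

lemma cycle_zero: "(\<lambda>_. 0) \<in> cycles K i"
  unfolding cycle_iff by (simp add: chain_zero vertex_boundary_def)

lemma cycle_add: "\<lbrakk>c \<in> cycles K i; d \<in> cycles K i\<rbrakk> \<Longrightarrow> (\<lambda>xs. c xs + d xs) \<in> cycles K i"
  unfolding cycle_iff by (simp add: chain_add vertex_boundary_add)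

lemma cycle_uminus:
  assumes "c \<in> cycles K i"
  shows "(\<lambda>xs. - c xs) \<in> cycles K i"
  using assms chain_uminus[of K i c] unfolding cycle_iff vertex_boundary_uminus by simp

lemma comm_group_cycle_group:
  "comm_group (cycle_group K i :: ('a list \<Rightarrow> 'k::comm_ring_1) monoid)"
  unfolding cycle_group_def
proof (rule comm_groupI, unfold partial_object.select_convs monoid.select_convs)
  fix c d e :: "'a list \<Rightarrow> 'k"
  assume c: "c \<in> cycles K i"
  have "(\<lambda>xs. - c xs + c xs) = (\<lambda>_. 0)" by simp
  then show "\<exists>d\<in>cycles K i. (\<lambda>xs. d xs + c xs) = (\<lambda>_. 0)"
    by (rule bexI[OF _ cycle_uminus[OF c]])
  assume "d \<in> cycles K i"
  with c show "(\<lambda>xs. c xs + d xs) \<in> cycles K i"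
    by (rule cycle_add)
  show "(\<lambda>xs. c xs + d xs) = (\<lambda>xs. d xs + c xs)"
    by (simp add: add.commute)
  show "(\<lambda>xs. c xs + d xs + e xs) = (\<lambda>xs. c xs + (d xs + e xs))"
    by (simp add: add.assoc)
qed (simp_all add: cycle_zero)

text \<open>Exactness makes every cycle a boundary, and the square of the boundary map is 0, so the
  cycle group is divided by itself.\<close>

lemma trivial_reduced_homology:
  assumes fin: "finite (\<Union>K)" and down: "\<And>\<sigma> \<tau>. \<lbrakk>\<sigma> \<in> K; \<tau> \<subseteq> \<sigma>\<rbrakk> \<Longrightarrow> \<tau> \<in> K"
    and exact: "exact_at TYPE('k::comm_ring_1) (\<Union>K) K i"
  shows "trivial_group (reduced_homology K i :: ('a list \<Rightarrow> 'k) set monoid)"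
proof -
  have "(c :: 'a list \<Rightarrow> 'k) \<in> boundaries K i \<longleftrightarrow> c \<in> cycles K i" for c
  proof
    assume "c \<in> boundaries K i"
    then obtain y where y: "chain K (i + 1) y" and c: "c = vertex_boundary (\<Union>K) y"
      unfolding boundaries_def boundary_eq_vertex_boundary by blast
    have "chain K (i + 1 - 1) c"
      unfolding c using y down by (rule chain_vertex_boundary)
    then show "c \<in> cycles K i"
      unfolding cycle_iff c vertex_boundary_vertex_boundary[OF y fin] by simp
  next
    assume "c \<in> cycles K i"
    then show "c \<in> boundaries K i"
      using exact unfolding cycle_iff exact_at_def boundaries_def boundary_eq_vertex_boundary
      by blast
  qed
  then have "boundaries K i = carrier (cycle_group K i :: ('a list \<Rightarrow> 'k) monoid)"
    unfolding cycle_group_def by auto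
  then show ?thesis
    unfolding reduced_homology_def by (simp add: trivial_group_Mod_carrier comm_group_cycle_group)
qed

section \<open>Skeleta of chordal independence complexes\<close>

text \<open>Generators correspond under removing and adding \<open>\<sigma>\<close>. That
  \<open>\<sigma>\<close> lies in the skeleton gives \<open>card \<sigma> \<le> n\<close>, so the
  difference is not truncated.\<close>

lemma link_generated_complex:
  assumes fin: "\<And>F. F \<in> K \<Longrightarrow> finite F" and "finite \<sigma>"
    and \<sigma>: "\<sigma> \<in> generated_complex {F \<in> K. card F = n}"
  shows "link (generated_complex {F \<in> K. card F = n}) \<sigma> =
    generated_complex {F \<in> link K \<sigma>. card F = n - card \<sigma>}" (is "?L = ?R")
proof (intro subset_antisym subsetI)
  fix \<tau> assume "\<tau> \<in> ?L"
  then obtain F where F: "\<tau> \<inter> \<sigma> = {}" "\<tau> \<union> \<sigma> \<subseteq> F" "F \<in> K" "card F = n"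
    by (auto simp: link_def generated_complex_def)
  then have "F - \<sigma> \<in> link K \<sigma>" "card (F - \<sigma>) = n - card \<sigma>" "\<tau> \<subseteq> F - \<sigma>"
    using \<open>finite \<sigma>\<close> by (auto simp: link_def Un_absorb2 card_Diff_subset)
  then show "\<tau> \<in> ?R"
    by (auto simp: generated_complex_def)
next
  fix \<tau> assume "\<tau> \<in> ?R"
  then obtain G where G: "\<tau> \<subseteq> G" "G \<inter> \<sigma> = {}" "G \<union> \<sigma> \<in> K" "card G = n - card \<sigma>"
    by (auto simp: link_def generated_complex_def)
  obtain F where "\<sigma> \<subseteq> F" "F \<in> K" "card F = n"
    using \<sigma> by (auto simp: generated_complex_def)
  then have "card \<sigma> \<le> n"
    using fin card_mono by blast
  then have "card (G \<union> \<sigma>) = n"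
    using G fin[OF G(3)] by (simp add: card_Un_disjoint)
  then show "\<tau> \<in> ?L"
    using G by (auto simp: link_def generated_complex_def)
qed

theorem sequentially_cohen_macaulay_chordal:
  fixes V :: "'a set"
  assumes "clutter V C" "chordal V C"
  shows "sequentially_cohen_macaulay TYPE('k::comm_ring_1) (independence_complex V C)"
  unfolding sequentially_cohen_macaulay_def cohen_macaulay_def
proof (intro allI ballI impI)
  fix d \<sigma> i
  let ?K = "independence_complex V C"
  assume \<sigma>: "\<sigma> \<in> pure_skeleton ?K d" and i: "i < complex_dim (link (pure_skeleton ?K d) \<sigma>)"
  have finV: "finite V"
    using assms(1) by (simp add: clutter_def)
  have KV: "F \<subseteq> V" if "F \<in> ?K" for F
    using that by (simp add: independence_complex_def)
  have finF: "finite F" if "F \<in> ?K" for F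
    using KV[OF that] finV by (rule finite_subset)
  obtain F where F: "F \<in> ?K" "\<sigma> \<subseteq> F" "face_dim F = d"
    using \<sigma> by (auto simp: pure_skeleton_def generated_complex_def)
  \<comment> \<open>Each generator of the link has as many vertices as a \<open>d\<close>-face above
    \<open>\<sigma>\<close> has outside \<open>\<sigma>\<close>.\<close>
  define m where "m = card F - card \<sigma>"
  define Y where "Y = {G \<in> link ?K \<sigma>. card G = m}"
  define P where "P = generated_complex Y"
  have "\<sigma> \<subseteq> V"
    using KV[OF F(1)] F(2) by blast
  then have "finite \<sigma>"
    using finV by (rule finite_subset)
  have skel: "pure_skeleton ?K d = generated_complex {G \<in> ?K. card G = card F}"
    using F(3) by (simp add: pure_skeleton_def face_dim_def eq_commute)
  have P: "link (pure_skeleton ?K d) \<sigma> = P"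
    using link_generated_complex[OF finF \<open>finite \<sigma>\<close>, where n = "card F"] \<sigma>
    unfolding skel P_def Y_def m_def by blast
  have YV: "G \<subseteq> V" if "G \<in> Y" for G
    using that KV[of "G \<union> \<sigma>"] by (auto simp: Y_def link_def)
  then have PV: "P \<subseteq> Pow V"
    by (auto simp: P_def generated_complex_def)
  then have "finite P"
    using finV by (simp add: finite_subset)
  have "{} \<in> P"
    unfolding P[symmetric] using \<sigma> by (simp add: link_def)
  have "face_dim \<tau> \<le> int m - 1" if "\<tau> \<in> P" for \<tau>
  proof -
    obtain G where "\<tau> \<subseteq> G" "G \<in> Y"
      using \<open>\<tau> \<in> P\<close> by (auto simp: P_def generated_complex_def)
    moreover from this have "finite G"
      using YV finV finite_subset by blast
    ultimately have "card \<tau> \<le> m"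
      by (auto simp: Y_def intro: card_mono)
    then show ?thesis by (simp add: face_dim_def)
  qed
  \<comment> \<open>An upper bound suffices: it places \<open>i\<close> below the dimension
    \<open>m - 1\<close> of every generator in \<open>Y\<close>.\<close>
  then have "complex_dim P \<le> int m - 1"
    unfolding complex_dim_def using \<open>finite P\<close> \<open>{} \<in> P\<close> by (intro Max.boundedI) auto
  then have i: "i < int m - 1"
    using i P by simp
  obtain D where "clutter (V - \<sigma>) D" "chordal (V - \<sigma>) D"
    "independence_complex (V - \<sigma>) D = link ?K \<sigma>"
    using link_chordal[OF \<open>finite \<sigma>\<close> \<open>\<sigma> \<subseteq> V\<close> assms] by blast
  then have "shelled Y"
    using shelled_chordal[of "V - \<sigma>" D] by (simp add: Y_def)
  moreover have fin: "finite (\<Union>P)"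
    using PV by (intro finite_subset[OF _ finV]) blast
  moreover have "G \<subseteq> \<Union>P \<and> i < face_dim G" if "G \<in> Y" for G
    using that i by (auto simp: P_def Y_def generated_complex_def face_dim_def)
  ultimately have "exact_at TYPE('k) (\<Union>P) P i"
    unfolding P_def by (rule exact_at_shelled)
  moreover have "\<tau> \<in> P" if "\<rho> \<in> P" "\<tau> \<subseteq> \<rho>" for \<rho> \<tau>
    using that unfolding P_def generated_complex_def by blast
  ultimately show "trivial_group
      (reduced_homology (link (pure_skeleton ?K d) \<sigma>) i :: ('a list \<Rightarrow> 'k) set monoid)"
    unfolding P by (intro trivial_reduced_homology fin)
qed

theorem theorem1p1:
  fixes V :: "'a set" and C :: "'a set set"
  assumes "clutter V C" and "chordal V C"
  shows "shellable (independence_complex V C)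
    \<and> sequentially_cohen_macaulay TYPE('k::field) (independence_complex V C)
    \<and> sequentially_cohen_macaulay TYPE(int) (independence_complex V C)"
proof (intro conjI sequentially_cohen_macaulay_chordal assms)
  have "finite \<sigma>" if "\<sigma> \<in> independence_complex V C" for \<sigma>
    using that assms(1) finite_subset[of \<sigma> V] by (simp add: independence_complex_def clutter_def)
  then show "shellable (independence_complex V C)"
    using shelled_chordal[OF assms] by (intro shellable_if_shelled_facets) auto
qed

end
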